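(* The monad structure $\mathbb{S}=(S,\eta^{\mathbb{S}},\mu^{\mathbb{S}})$ on the functor $S\colon\mathbf{Meas}\to\mathbf{Meas}$ induced by the natural isomorphism $\Lambda\colon S\cong F$ (that is, the unique monad structure on $S$ making $\Lambda$ a morphism of monads to the finitely additive Giry monad $\mathbb{F}$) is given by $\eta^{\mathbb{S}}_\Omega(\omega)(f)=f(\omega)$ for $\Omega\in\mathbf{Meas}$, $\omega\in\Omega$, $f\in\mathbf{Meas}(\Omega,I)$, and $\mu^{\mathbb{S}}_\Omega(\psi)(f)=\psi(\mathrm{ev}_f)$ for $\psi\in SS\Omega$ and $f\in\mathbf{Meas}(\Omega,I)$, where $\mathrm{ev}_f\colon S\Omega\to I$, $\phi\mapsto\phi(f)$. Similarly, the monad structure on $T$ induced by the natural isomorphism $\Xi\colon T\cong G$ from the Giry monad $\mathbb{G}$ is given by the same formulas with $T$ in place of $S$: the unit is $\omega\mapsto(f\mapsto f(\omega))$ and the multiplication is $\psi\mapsto(f\mapsto\psi(\mathrm{ev}_f))$ for $\psi\in TT\Omega$, with $\mathrm{ev}_f\colon T\Omega\to I$.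
   Context: $I=[0,1]$ with its Borel $\sigma$-algebra; $\mathbf{Meas}$ is the category of measurable spaces and measurable maps; $\bar r$ denotes the constant function with value $r$. Integration operators. A finitely additive integration operator on $\Omega$ is a function $\phi\colon\mathbf{Meas}(\Omega,I)\to I$ that is affine ($\phi(rf+(1-r)g)=r\phi(f)+(1-r)\phi(g)$ for all $f,g\in\mathbf{Meas}(\Omega,I)$, $r\in I$) and weakly averaging ($\phi(\bar r)=r$ for all $r\in I$). It is an integration operator if additionally $\phi(f_n)\to0$ whenever $f_n\in\mathbf{Meas}(\Omega,I)$ converges pointwise to $0$. $S\Omega$ (resp. $T\Omega$) is the set of finitely additive integration operators (resp. integration operators) on $\Omega$ with the smallest $\sigma$-algebra making every $\mathrm{ev}_f$, $\phi\mapsto\phi(f)$ ($f\in\mathbf{Meas}(\Omega,I)$), measurable. For measurable $g\colon\Omega\to\Omega'$, $Sg(\phi)(f)=\phi(f\circ g)$ for $f\in\mathbf{Meas}(\Omega',I)$, and $Tg$ is defined likewise. Thus $S$, $T$ are functors $\mathbf{Meas}\to\mathbf{Meas}$. Giry monads. A finitely additive probability measure on $(\Omega,\Sigma)$ is $\pi\colon\Sigma\to I$ with $\pi(\Omega)=1$ and $\pi(A\cup B)=\pi(A)+\pi(B)$ for disjoint $A,B\in\Sigma$; it is a probability measure if it is moreover countably additive. For a finitely additive probability measure $\pi$ and measurable $f\colon\Omega\to I$, $\int_\Omega f\,d\pi$ is the supremum of $\int_\Omega f'\,d\pi$ over simple functions $f'\le f$, where $\int_\Omega \sum_i a_i\chi_{A_i}\,d\pi=\sum_i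 a_i\pi(A_i)$. $F\Omega$ is the set of finitely additive probability measures on $\Omega$ with the smallest $\sigma$-algebra making every $\mathrm{ev}_A\colon F\Omega\to I$, $\pi\mapsto\pi(A)$, measurable; $G\Omega\subseteq F\Omega$ is the subspace of probability measures. $Fg(\pi)(A')=\pi(g^{-1}(A'))$, and $Gg$ is the restriction. The finitely additive Giry monad $\mathbb{F}$ has unit $\eta_\Omega(\omega)(A)=\chi_A(\omega)$ and multiplication $\mu_\Omega(\rho)(A)=\int_{F\Omega}\mathrm{ev}_A\,d\rho$; the Giry monad $\mathbb{G}$ is defined by the same formulas with $G$ in place of $F$. The isomorphisms. $\Lambda_\Omega\colon S\Omega\to F\Omega$ is $\Lambda_\Omega(\phi)(A)=\phi(\chi_A)$; it is a natural isomorphism $S\cong F$ of functors $\mathbf{Meas}\to\mathbf{Meas}$, with inverse $\pi\mapsto\left(f\mapsto\int_\Omega f\,d\pi\right)$, and restricts to a natural isomorphism $\Xi\colon T\cong G$. *)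

theory Defs
  imports "HOL-Analysis.Analysis"
begin

text \<open>
  A measurable space is represented by a value of type \<^typ>\<open>'a measure\<close>, of which only
  \<^const>\<open>space\<close> and \<^const>\<open>sets\<close> are used. All maps are extensional (\<^const>\<open>undefined\<close> off their
  domain), so that HOL equality is equality of maps between the carriers. The functors and natural
  transformations are given by their components, polymorphically in the carrier type.
\<close>

definition unit_I :: "real measure" where
  "unit_I = restrict_space borel {0..1}"

definition meas_hom :: "'a measure \<Rightarrow> 'b measure \<Rightarrow> ('a \<Rightarrow> 'b) set" where
  "meas_hom X Y = (X \<rightarrow>\<^sub>M Y) \<inter> extensional (space X)"

definition id_map :: "'a measure \<Rightarrow> 'a \<Rightarrow> 'a" where
  "id_map X = (\<lambda>x\<in>space X. x)"

definition chi :: "'a measure \<Rightarrow> 'a set \<Rightarrow> 'a \<Rightarrow> real" where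
  "chi X A = (\<lambda>x\<in>space X. indicator A x)"

text \<open>Evaluation at \<open>j\<close> (a function or a measurable set), on a space of functionals \<open>X\<close>.\<close>

definition ev :: "('i \<Rightarrow> real) measure \<Rightarrow> 'i \<Rightarrow> ('i \<Rightarrow> real) \<Rightarrow> real" where
  "ev X j = (\<lambda>x\<in>space X. x j)"

text \<open>\<open>C\<close> with the smallest \<open>\<sigma>\<close>-algebra making all evaluations \<open>x \<mapsto> x j\<close>, \<open>j \<in> J\<close>, measurable into
  the unit interval.\<close>

definition eval_space :: "'i set \<Rightarrow> ('i \<Rightarrow> real) set \<Rightarrow> ('i \<Rightarrow> real) measure" where
  "eval_space J C = sigma C {{x \<in> C. x j \<in> B} | j B. j \<in> J \<and> B \<in> sets unit_I}"


section \<open>Integration operators: the functors S and T\<close>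

definition fa_integration_operators :: "'a measure \<Rightarrow> (('a \<Rightarrow> real) \<Rightarrow> real) set" where
  "fa_integration_operators \<Omega> = {\<phi> \<in> meas_hom \<Omega> unit_I \<rightarrow>\<^sub>E {0..1}.
     (\<forall>f\<in>meas_hom \<Omega> unit_I. \<forall>g\<in>meas_hom \<Omega> unit_I. \<forall>r\<in>{0..1}.
        \<phi> (\<lambda>\<omega>\<in>space \<Omega>. r * f \<omega> + (1 - r) * g \<omega>) = r * \<phi> f + (1 - r) * \<phi> g) \<and>
     (\<forall>r\<in>{0..1}. \<phi> (\<lambda>\<omega>\<in>space \<Omega>. r) = r)}"

definition integration_operators :: "'a measure \<Rightarrow> (('a \<Rightarrow> real) \<Rightarrow> real) set" where
  "integration_operators \<Omega> = {\<phi> \<in> fa_integration_operators \<Omega>.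
     \<forall>f :: nat \<Rightarrow> 'a \<Rightarrow> real. (\<forall>n. f n \<in> meas_hom \<Omega> unit_I) \<longrightarrow>
       (\<forall>\<omega>\<in>space \<Omega>. (\<lambda>n. f n \<omega>) \<longlonglongrightarrow> 0) \<longrightarrow> (\<lambda>n. \<phi> (f n)) \<longlonglongrightarrow> 0}"

definition Sobj :: "'a measure \<Rightarrow> (('a \<Rightarrow> real) \<Rightarrow> real) measure" where
  "Sobj \<Omega> = eval_space (meas_hom \<Omega> unit_I) (fa_integration_operators \<Omega>)"

definition Tobj :: "'a measure \<Rightarrow> (('a \<Rightarrow> real) \<Rightarrow> real) measure" where
  "Tobj \<Omega> = eval_space (meas_hom \<Omega> unit_I) (integration_operators \<Omega>)"

definition Smap :: "'a measure \<Rightarrow> 'b measure \<Rightarrow> ('a \<Rightarrow> 'b) \<Rightarrow>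
    (('a \<Rightarrow> real) \<Rightarrow> real) \<Rightarrow> (('b \<Rightarrow> real) \<Rightarrow> real)" where
  "Smap \<Omega> \<Omega>' g = (\<lambda>\<phi>\<in>space (Sobj \<Omega>). \<lambda>f\<in>meas_hom \<Omega>' unit_I. \<phi> (compose (space \<Omega>) f g))"

definition Tmap :: "'a measure \<Rightarrow> 'b measure \<Rightarrow> ('a \<Rightarrow> 'b) \<Rightarrow>
    (('a \<Rightarrow> real) \<Rightarrow> real) \<Rightarrow> (('b \<Rightarrow> real) \<Rightarrow> real)" where
  "Tmap \<Omega> \<Omega>' g = (\<lambda>\<phi>\<in>space (Tobj \<Omega>). \<lambda>f\<in>meas_hom \<Omega>' unit_I. \<phi> (compose (space \<Omega>) f g))"

definition Sunit :: "'a measure \<Rightarrow> 'a \<Rightarrow> ('a \<Rightarrow> real) \<Rightarrow> real" where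
  "Sunit \<Omega> = (\<lambda>\<omega>\<in>space \<Omega>. \<lambda>f\<in>meas_hom \<Omega> unit_I. f \<omega>)"

definition Smult :: "'a measure \<Rightarrow>
    (((('a \<Rightarrow> real) \<Rightarrow> real) \<Rightarrow> real) \<Rightarrow> real) \<Rightarrow> ('a \<Rightarrow> real) \<Rightarrow> real" where
  "Smult \<Omega> = (\<lambda>\<psi>\<in>space (Sobj (Sobj \<Omega>)). \<lambda>f\<in>meas_hom \<Omega> unit_I. \<psi> (ev (Sobj \<Omega>) f))"

definition Tunit :: "'a measure \<Rightarrow> 'a \<Rightarrow> ('a \<Rightarrow> real) \<Rightarrow> real" where
  "Tunit \<Omega> = (\<lambda>\<omega>\<in>space \<Omega>. \<lambda>f\<in>meas_hom \<Omega> unit_I. f \<omega>)"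

definition Tmult :: "'a measure \<Rightarrow>
    (((('a \<Rightarrow> real) \<Rightarrow> real) \<Rightarrow> real) \<Rightarrow> real) \<Rightarrow> ('a \<Rightarrow> real) \<Rightarrow> real" where
  "Tmult \<Omega> = (\<lambda>\<psi>\<in>space (Tobj (Tobj \<Omega>)). \<lambda>f\<in>meas_hom \<Omega> unit_I. \<psi> (ev (Tobj \<Omega>) f))"


section \<open>The finitely additive Giry monad F and the Giry monad G\<close>

definition fa_prob_measures :: "'a measure \<Rightarrow> ('a set \<Rightarrow> real) set" where
  "fa_prob_measures \<Omega> = {\<pi> \<in> sets \<Omega> \<rightarrow>\<^sub>E {0..1}.
     \<pi> (space \<Omega>) = 1 \<and> Measure_Space.additive (sets \<Omega>) \<pi>}"

definition prob_measures :: "'a measure \<Rightarrow> ('a set \<Rightarrow> real) set" where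
  "prob_measures \<Omega> = {\<pi> \<in> fa_prob_measures \<Omega>.
     \<forall>A :: nat \<Rightarrow> 'a set. range A \<subseteq> sets \<Omega> \<longrightarrow> disjoint_family A \<longrightarrow>
       (\<lambda>n. \<pi> (A n)) sums \<pi> (\<Union>n. A n)}"

text \<open>The integral of a simple function uses its canonical representation over its finitely many
  values; by additivity of \<open>\<pi>\<close> every other representation gives the same value.\<close>

definition fa_simple_integral :: "'a measure \<Rightarrow> ('a set \<Rightarrow> real) \<Rightarrow> ('a \<Rightarrow> real) \<Rightarrow> real" where
  "fa_simple_integral \<Omega> \<pi> f = (\<Sum>a\<in>f ` space \<Omega>. a * \<pi> (f -` {a} \<inter> space \<Omega>))"

definition fa_integral :: "'a measure \<Rightarrow> ('a set \<Rightarrow> real) \<Rightarrow> ('a \<Rightarrow> real) \<Rightarrow> real" where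
  "fa_integral \<Omega> \<pi> f = Sup {fa_simple_integral \<Omega> \<pi> f' | f'.
     f' \<in> meas_hom \<Omega> unit_I \<and> simple_function \<Omega> f' \<and> (\<forall>\<omega>\<in>space \<Omega>. f' \<omega> \<le> f \<omega>)}"

definition Fobj :: "'a measure \<Rightarrow> ('a set \<Rightarrow> real) measure" where
  "Fobj \<Omega> = eval_space (sets \<Omega>) (fa_prob_measures \<Omega>)"

definition Gobj :: "'a measure \<Rightarrow> ('a set \<Rightarrow> real) measure" where
  "Gobj \<Omega> = restrict_space (Fobj \<Omega>) (prob_measures \<Omega>)"

definition Fmap :: "'a measure \<Rightarrow> 'b measure \<Rightarrow> ('a \<Rightarrow> 'b) \<Rightarrow> ('a set \<Rightarrow> real) \<Rightarrow> ('b set \<Rightarrow> real)" where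
  "Fmap \<Omega> \<Omega>' g = (\<lambda>\<pi>\<in>space (Fobj \<Omega>). \<lambda>A\<in>sets \<Omega>'. \<pi> (g -` A \<inter> space \<Omega>))"

definition Gmap :: "'a measure \<Rightarrow> 'b measure \<Rightarrow> ('a \<Rightarrow> 'b) \<Rightarrow> ('a set \<Rightarrow> real) \<Rightarrow> ('b set \<Rightarrow> real)" where
  "Gmap \<Omega> \<Omega>' g = restrict (Fmap \<Omega> \<Omega>' g) (space (Gobj \<Omega>))"

definition Funit :: "'a measure \<Rightarrow> 'a \<Rightarrow> 'a set \<Rightarrow> real" where
  "Funit \<Omega> = (\<lambda>\<omega>\<in>space \<Omega>. \<lambda>A\<in>sets \<Omega>. chi \<Omega> A \<omega>)"

definition Fmult :: "'a measure \<Rightarrow> (('a set \<Rightarrow> real) set \<Rightarrow> real) \<Rightarrow> 'a set \<Rightarrow> real" where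
  "Fmult \<Omega> = (\<lambda>\<rho>\<in>space (Fobj (Fobj \<Omega>)). \<lambda>A\<in>sets \<Omega>. fa_integral (Fobj \<Omega>) \<rho> (ev (Fobj \<Omega>) A))"

definition Gunit :: "'a measure \<Rightarrow> 'a \<Rightarrow> 'a set \<Rightarrow> real" where
  "Gunit \<Omega> = (\<lambda>\<omega>\<in>space \<Omega>. \<lambda>A\<in>sets \<Omega>. chi \<Omega> A \<omega>)"

definition Gmult :: "'a measure \<Rightarrow> (('a set \<Rightarrow> real) set \<Rightarrow> real) \<Rightarrow> 'a set \<Rightarrow> real" where
  "Gmult \<Omega> = (\<lambda>\<rho>\<in>space (Gobj (Gobj \<Omega>)). \<lambda>A\<in>sets \<Omega>. fa_integral (Gobj \<Omega>) \<rho> (ev (Gobj \<Omega>) A))"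


section \<open>The comparison maps\<close>

definition Lam :: "'a measure \<Rightarrow> (('a \<Rightarrow> real) \<Rightarrow> real) \<Rightarrow> 'a set \<Rightarrow> real" where
  "Lam \<Omega> = (\<lambda>\<phi>\<in>space (Sobj \<Omega>). \<lambda>A\<in>sets \<Omega>. \<phi> (chi \<Omega> A))"

definition Xi :: "'a measure \<Rightarrow> (('a \<Rightarrow> real) \<Rightarrow> real) \<Rightarrow> 'a set \<Rightarrow> real" where
  "Xi \<Omega> = restrict (Lam \<Omega>) (space (Tobj \<Omega>))"

text \<open>The components at \<open>\<Omega>\<close> of the horizontal composites \<open>SS \<Rightarrow> FF\<close> and \<open>TT \<Rightarrow> GG\<close>.\<close>

definition LamLam :: "'a measure \<Rightarrow>
    (((('a \<Rightarrow> real) \<Rightarrow> real) \<Rightarrow> real) \<Rightarrow> real) \<Rightarrow> ('a set \<Rightarrow> real) set \<Rightarrow> real" where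
  "LamLam \<Omega> = compose (space (Sobj (Sobj \<Omega>)))
     (Fmap (Sobj \<Omega>) (Fobj \<Omega>) (Lam \<Omega>)) (Lam (Sobj \<Omega>))"

definition XiXi :: "'a measure \<Rightarrow>
    (((('a \<Rightarrow> real) \<Rightarrow> real) \<Rightarrow> real) \<Rightarrow> real) \<Rightarrow> ('a set \<Rightarrow> real) set \<Rightarrow> real" where
  "XiXi \<Omega> = compose (space (Tobj (Tobj \<Omega>)))
     (Gmap (Tobj \<Omega>) (Gobj \<Omega>) (Xi \<Omega>)) (Xi (Tobj \<Omega>))"


section \<open>Monads and their morphisms, componentwise\<close>

text \<open>Naturality on morphisms \<open>X \<rightarrow> Y\<close> of a transformation \<open>H \<Rightarrow> K\<close> with components
  \<open>a\<close> at \<open>X\<close> and \<open>b\<close> at \<open>Y\<close>; \<open>HX\<close> is the value of \<open>H\<close> at \<open>X\<close>.\<close>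

definition natural_at :: "'a measure \<Rightarrow> 'b measure \<Rightarrow> 'c measure \<Rightarrow>
    (('a \<Rightarrow> 'b) \<Rightarrow> 'c \<Rightarrow> 'd) \<Rightarrow> (('a \<Rightarrow> 'b) \<Rightarrow> 'e \<Rightarrow> 'f) \<Rightarrow> ('c \<Rightarrow> 'e) \<Rightarrow> ('d \<Rightarrow> 'f) \<Rightarrow> bool" where
  "natural_at X Y HX H K a b \<longleftrightarrow>
     (\<forall>g\<in>meas_hom X Y. compose (space HX) b (H g) = compose (space HX) (K g) a)"

text \<open>The monad laws at \<open>X\<close> for an endofunctor with values \<open>X1\<close>, \<open>X2\<close>, \<open>X3\<close> of its iterates at \<open>X\<close>:
  \<open>\<eta>\<close>, \<open>\<mu>\<close> are the components at \<open>X\<close>; \<open>\<eta>1\<close>, \<open>\<mu>1\<close> those at \<open>X1\<close>; and \<open>H\<eta>\<close>, \<open>H\<mu>\<close> the images of \<open>\<eta>\<close>,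
  \<open>\<mu>\<close> under the functor.\<close>

definition monad_at :: "'a measure \<Rightarrow> 'b measure \<Rightarrow> 'c measure \<Rightarrow> 'd measure \<Rightarrow>
    ('a \<Rightarrow> 'b) \<Rightarrow> ('c \<Rightarrow> 'b) \<Rightarrow> ('b \<Rightarrow> 'c) \<Rightarrow> ('d \<Rightarrow> 'c) \<Rightarrow> ('b \<Rightarrow> 'c) \<Rightarrow> ('d \<Rightarrow> 'c) \<Rightarrow> bool" where
  "monad_at X X1 X2 X3 \<eta> \<mu> \<eta>1 \<mu>1 H\<eta> H\<mu> \<longleftrightarrow>
     \<eta> \<in> meas_hom X X1 \<and> \<mu> \<in> meas_hom X2 X1 \<and>
     compose (space X1) \<mu> \<eta>1 = id_map X1 \<and>
     compose (space X1) \<mu> H\<eta> = id_map X1 \<and>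
     compose (space X3) \<mu> \<mu>1 = compose (space X3) \<mu> H\<mu>"

text \<open>Compatibility at \<open>X\<close> of a transformation with units and multiplications: \<open>l\<close> is its component
  at \<open>X\<close>, \<open>ll\<close> that of its horizontal square, \<open>\<eta>\<close>, \<open>\<mu>\<close> belong to the source and \<open>\<eta>'\<close>, \<open>\<mu>'\<close> to the
  target; \<open>X2\<close> is the value at \<open>X\<close> of the square of the source functor.\<close>

definition monad_morphism_at :: "'a measure \<Rightarrow> 'c measure \<Rightarrow> ('b \<Rightarrow> 'e) \<Rightarrow> ('c \<Rightarrow> 'f) \<Rightarrow>
    ('a \<Rightarrow> 'b) \<Rightarrow> ('c \<Rightarrow> 'b) \<Rightarrow> ('a \<Rightarrow> 'e) \<Rightarrow> ('f \<Rightarrow> 'e) \<Rightarrow> bool" where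
  "monad_morphism_at X X2 l ll \<eta> \<mu> \<eta>' \<mu>' \<longleftrightarrow>
     compose (space X) l \<eta> = \<eta>' \<and> compose (space X2) l \<mu> = compose (space X2) \<mu>' ll"

end

theory Submission
  imports Defs
begin

text \<open>
  An affine, weakly averaging \<open>\<phi>\<close> is additive and monotone. On simple functions it is therefore the
  integral against \<open>\<Lambda>(\<phi>)\<close>, and approximating \<open>f\<close> from below by \<open>\<lfloor>n f\<rfloor> / n\<close> extends this to all
  measurable \<open>f\<close>. Hence \<open>\<Lambda>\<close> is injective, which gives uniqueness; and compatibility with the
  multiplications follows by applying the same formula to \<open>S\<Lambda>(\<psi>)\<close> on \<open>F\<Omega>\<close>:
  \<open>\<integral> ev\<^sub>A d(\<Lambda>\<Lambda>)(\<psi>) = \<psi> (ev\<^sub>A \<circ> \<Lambda>)\<close>. All the other laws amount to evaluating both sides.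
\<close>

section \<open>Maps into the unit interval and evaluation spaces\<close>

lemma meas_hom_unit_iff:
  "f \<in> meas_hom X unit_I \<longleftrightarrow>
     f \<in> borel_measurable X \<and> (\<forall>x\<in>space X. 0 \<le> f x \<and> f x \<le> 1) \<and> f \<in> extensional (space X)"
  unfolding meas_hom_def unit_I_def by (auto simp: measurable_restrict_space2_iff)

text \<open>Measurability depends only on the values on the carrier, so cutting a map down to its
  extensional representative is harmless.\<close>

lemma meas_hom_restrictI:
  assumes "g \<in> X \<rightarrow>\<^sub>M Y"
  shows "(\<lambda>x\<in>space X. g x) \<in> meas_hom X Y"
proof -
  have "(\<lambda>x\<in>space X. g x) \<in> X \<rightarrow>\<^sub>M Y \<longleftrightarrow> g \<in> X \<rightarrow>\<^sub>M Y"
    by (rule measurable_cong) simp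
  with assms show ?thesis by (simp add: meas_hom_def)
qed

lemma meas_hom_unit_restrictI:
  assumes "g \<in> borel_measurable X" "\<And>x. x \<in> space X \<Longrightarrow> 0 \<le> g x" "\<And>x. x \<in> space X \<Longrightarrow> g x \<le> 1"
  shows "(\<lambda>x\<in>space X. g x) \<in> meas_hom X unit_I"
  using assms by (intro meas_hom_restrictI) (auto simp: unit_I_def measurable_restrict_space2_iff)

lemma meas_hom_unit_measurable [measurable_dest]:
  "f \<in> meas_hom X unit_I \<Longrightarrow> f \<in> borel_measurable X"
  by (simp add: meas_hom_unit_iff)

lemma meas_hom_unit_bounds:
  assumes "f \<in> meas_hom X unit_I" "x \<in> space X"
  shows "0 \<le> f x" "f x \<le> 1"
  using assms by (auto simp: meas_hom_unit_iff)

lemma meas_hom_extensional: "f \<in> meas_hom X Y \<Longrightarrow> f \<in> extensional (space X)"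
  by (simp add: meas_hom_def)

lemma meas_hom_space: "f \<in> meas_hom X Y \<Longrightarrow> x \<in> space X \<Longrightarrow> f x \<in> space Y"
  by (auto simp: meas_hom_def dest: measurable_space)

lemma meas_hom_unit_const: "r \<in> {0..1} \<Longrightarrow> (\<lambda>x\<in>space X. r) \<in> meas_hom X unit_I"
  by (rule meas_hom_unit_restrictI) auto

text \<open>The interval is convex. This keeps the argument on the left of the affinity law inside
  the domain of an operator, where extensional functionals carry information.\<close>

lemma meas_hom_unit_affine:
  assumes f: "f \<in> meas_hom X unit_I" and g: "g \<in> meas_hom X unit_I" and r: "r \<in> {0..1}"
  shows "(\<lambda>x\<in>space X. r * f x + (1 - r) * g x) \<in> meas_hom X unit_I"
proof (rule meas_hom_unit_restrictI)
  show "(\<lambda>x. r * f x + (1 - r) * g x) \<in> borel_measurable X"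
    using f g by measurable
  fix x assume x: "x \<in> space X"
  show "0 \<le> r * f x + (1 - r) * g x"
    using meas_hom_unit_bounds[OF f x] meas_hom_unit_bounds[OF g x] r by simp
  show "r * f x + (1 - r) * g x \<le> 1"
    using meas_hom_unit_bounds[OF f x] meas_hom_unit_bounds[OF g x] r
    by (intro convex_bound_le) auto
qed

lemma meas_hom_compose:
  assumes "g \<in> meas_hom X Y" "f \<in> meas_hom Y Z"
  shows "compose (space X) f g \<in> meas_hom X Z"
proof -
  have "(\<lambda>x. f (g x)) \<in> X \<rightarrow>\<^sub>M Z"
    using assms by (auto simp: meas_hom_def)
  then show ?thesis
    unfolding compose_def by (rule meas_hom_restrictI)
qed

lemma chi_meas_hom: "A \<in> sets X \<Longrightarrow> chi X A \<in> meas_hom X unit_I"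
  unfolding chi_def by (rule meas_hom_unit_restrictI) (auto simp: indicator_def)

text \<open>Links the two functors: precomposition with \<open>g\<close>, used for operators,
  becomes preimage under \<open>g\<close>, used for measures. Naturality of the comparison rests on
  it.\<close>

lemma chi_compose:
  assumes "g \<in> meas_hom X Y"
  shows "compose (space X) (chi Y A) g = chi X (g -` A \<inter> space X)"
  using meas_hom_space[OF assms] by (auto simp: compose_def chi_def fun_eq_iff indicator_def)

section \<open>Sigma-algebras generated by evaluations\<close>

lemma space_eval_space [simp]: "space (eval_space J C) = C"
  unfolding eval_space_def by (subst space_measure_of) auto

text \<open>The universal property of the initial sigma-algebra: only preimages of generators have
  to be checked, and those are preimages under the components of \<open>h\<close>.\<close>

lemma measurable_eval_spaceI:
  assumes "\<And>x. x \<in> space M \<Longrightarrow> h x \<in> C"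
    and "\<And>j. j \<in> J \<Longrightarrow> (\<lambda>x. h x j) \<in> M \<rightarrow>\<^sub>M unit_I"
  shows "h \<in> M \<rightarrow>\<^sub>M eval_space J C"
  unfolding eval_space_def
proof (rule measurable_measure_of)
  fix y assume "y \<in> {{x \<in> C. x j \<in> B} |j B. j \<in> J \<and> B \<in> sets unit_I}"
  then obtain j B where y: "y = {x \<in> C. x j \<in> B}" "j \<in> J" "B \<in> sets unit_I"
    by auto
  have "h -` y \<inter> space M = (\<lambda>x. h x j) -` B \<inter> space M"
    using assms(1) y(1) by auto
  then show "h -` y \<inter> space M \<in> sets M"
    using measurable_sets[OF assms(2)] y(2,3) by simp
qed (use assms(1) in auto)

lemma measurable_eval_space_component:
  assumes "j \<in> J" "\<And>x. x \<in> C \<Longrightarrow> x j \<in> {0..1}"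
  shows "(\<lambda>x. x j) \<in> eval_space J C \<rightarrow>\<^sub>M unit_I"
proof (rule measurableI)
  fix B assume "B \<in> sets unit_I"
  then have "{x \<in> C. x j \<in> B} \<in> {{x \<in> C. x j \<in> B} | j B. j \<in> J \<and> B \<in> sets unit_I}"
    using assms(1) by blast
  then have "{x \<in> C. x j \<in> B} \<in> sets (eval_space J C)"
    unfolding eval_space_def by (subst sets_measure_of) auto
  moreover have "(\<lambda>x. x j) -` B \<inter> space (eval_space J C) = {x \<in> C. x j \<in> B}"
    by auto
  ultimately show "(\<lambda>x. x j) -` B \<inter> space (eval_space J C) \<in> sets (eval_space J C)"
    by simp
qed (use assms(2) in \<open>auto simp: unit_I_def space_restrict_space\<close>)


section \<open>Integration operators as integrals\<close>

context
  fixes \<Omega> :: "'a measure" and \<phi> :: "('a \<Rightarrow> real) \<Rightarrow> real"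
  assumes \<phi>: "\<phi> \<in> fa_integration_operators \<Omega>"
begin

lemma fa_operator_bounds:
  assumes "f \<in> meas_hom \<Omega> unit_I"
  shows "0 \<le> \<phi> f" "\<phi> f \<le> 1"
  using \<phi> assms by (auto simp: fa_integration_operators_def PiE_iff)

lemma fa_operator_const: "r \<in> {0..1} \<Longrightarrow> \<phi> (\<lambda>\<omega>\<in>space \<Omega>. r) = r"
  using \<phi> by (auto simp: fa_integration_operators_def)

lemma fa_operator_affine:
  "f \<in> meas_hom \<Omega> unit_I \<Longrightarrow> g \<in> meas_hom \<Omega> unit_I \<Longrightarrow> r \<in> {0..1} \<Longrightarrow>
     \<phi> (\<lambda>\<omega>\<in>space \<Omega>. r * f \<omega> + (1 - r) * g \<omega>) = r * \<phi> f + (1 - r) * \<phi> g"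
  using \<phi> by (auto simp: fa_integration_operators_def)

text \<open>Affinity with the zero function as second argument, whose value is 0 by weak
  averaging.\<close>

lemma fa_operator_scale:
  assumes f: "f \<in> meas_hom \<Omega> unit_I" and r: "r \<in> {0..1}"
  shows "\<phi> (\<lambda>\<omega>\<in>space \<Omega>. r * f \<omega>) = r * \<phi> f"
proof -
  have "(\<lambda>\<omega>\<in>space \<Omega>. 0) \<in> meas_hom \<Omega> unit_I"
    by (rule meas_hom_unit_restrictI) auto
  from fa_operator_affine[OF f this r]
  have "\<phi> (\<lambda>\<omega>\<in>space \<Omega>. r * f \<omega> + (1 - r) * (\<lambda>\<omega>\<in>space \<Omega>. 0) \<omega>) = r * \<phi> f"
    by (simp add: fa_operator_const)
  also have "(\<lambda>\<omega>\<in>space \<Omega>. r * f \<omega> + (1 - r) * (\<lambda>\<omega>\<in>space \<Omega>. 0) \<omega>) = (\<lambda>\<omega>\<in>space \<Omega>. r * f \<omega>)"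
    by (auto simp: fun_eq_iff)
  finally show ?thesis .
qed

text \<open>The sum of two maps into the interval may leave it, so \<open>h\<close> is given
  separately. Half of \<open>h\<close> is the midpoint of \<open>f\<close> and \<open>g\<close>;
  affinity at 1/2 and scaling by 1/2 compute its value in two ways.\<close>

lemma fa_operator_add:
  assumes f: "f \<in> meas_hom \<Omega> unit_I" and g: "g \<in> meas_hom \<Omega> unit_I"
    and h: "h \<in> meas_hom \<Omega> unit_I" and eq: "\<And>\<omega>. \<omega> \<in> space \<Omega> \<Longrightarrow> h \<omega> = f \<omega> + g \<omega>"
  shows "\<phi> h = \<phi> f + \<phi> g"
proof -
  have "(\<lambda>\<omega>\<in>space \<Omega>. (1/2) * h \<omega>) = (\<lambda>\<omega>\<in>space \<Omega>. (1/2) * f \<omega> + (1 - 1/2) * g \<omega>)"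
    by (auto simp: fun_eq_iff eq field_simps)
  then have "(1/2) * \<phi> h = (1/2) * \<phi> f + (1 - 1/2) * \<phi> g"
    using fa_operator_scale[OF h, of "1/2"] fa_operator_affine[OF f g, of "1/2"] by simp
  then show ?thesis by simp
qed

text \<open>The difference is again a map into the interval, so \<open>g\<close> splits as a sum to
  which additivity applies. Monotonicity follows because the value on the difference is
  nonnegative.\<close>

lemma fa_operator_diff:
  assumes f: "f \<in> meas_hom \<Omega> unit_I" and g: "g \<in> meas_hom \<Omega> unit_I"
    and le: "\<And>\<omega>. \<omega> \<in> space \<Omega> \<Longrightarrow> f \<omega> \<le> g \<omega>"
  shows "(\<lambda>\<omega>\<in>space \<Omega>. g \<omega> - f \<omega>) \<in> meas_hom \<Omega> unit_I"
    and "\<phi> g = \<phi> f + \<phi> (\<lambda>\<omega>\<in>space \<Omega>. g \<omega> - f \<omega>)"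
proof -
  show d: "(\<lambda>\<omega>\<in>space \<Omega>. g \<omega> - f \<omega>) \<in> meas_hom \<Omega> unit_I"
  proof (rule meas_hom_unit_restrictI)
    show "(\<lambda>\<omega>. g \<omega> - f \<omega>) \<in> borel_measurable \<Omega>"
      using f g by measurable
    fix \<omega> assume w: "\<omega> \<in> space \<Omega>"
    show "0 \<le> g \<omega> - f \<omega>" using le[OF w] by simp
    show "g \<omega> - f \<omega> \<le> 1"
      using meas_hom_unit_bounds[OF f w] meas_hom_unit_bounds[OF g w] by simp
  qed
  show "\<phi> g = \<phi> f + \<phi> (\<lambda>\<omega>\<in>space \<Omega>. g \<omega> - f \<omega>)"
    by (rule fa_operator_add[OF f d g]) simp
qed

lemma fa_operator_mono:
  assumes "f \<in> meas_hom \<Omega> unit_I" "g \<in> meas_hom \<Omega> unit_I"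
    and "\<And>\<omega>. \<omega> \<in> space \<Omega> \<Longrightarrow> f \<omega> \<le> g \<omega>"
  shows "\<phi> f \<le> \<phi> g"
  using fa_operator_diff[OF assms] fa_operator_bounds(1) by fastforce

section \<open>The associated set function and integration against it\<close>

lemma Lam_apply:
  assumes "A \<in> sets \<Omega>"
  shows "Lam \<Omega> \<phi> A = \<phi> (chi \<Omega> A)"
  using \<phi> assms by (simp add: Lam_def Sobj_def)

text \<open>The indicator of the whole space is the constant 1, and the indicator of a disjoint
  union is the sum of the indicators.\<close>

lemma Lam_fa_prob_measure: "Lam \<Omega> \<phi> \<in> fa_prob_measures \<Omega>"
proof -
  have "Lam \<Omega> \<phi> \<in> sets \<Omega> \<rightarrow>\<^sub>E {0..1}"
    using \<phi> by (auto simp: Lam_apply fa_operator_bounds chi_meas_hom Lam_def Sobj_def)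
  moreover have "Lam \<Omega> \<phi> (space \<Omega>) = 1"
  proof -
    have "chi \<Omega> (space \<Omega>) = (\<lambda>\<omega>\<in>space \<Omega>. 1)"
      by (auto simp: chi_def fun_eq_iff)
    then show ?thesis by (simp add: Lam_apply fa_operator_const)
  qed
  moreover have "Measure_Space.additive (sets \<Omega>) (Lam \<Omega> \<phi>)"
  proof (unfold Measure_Space.additive_def, intro ballI impI)
    fix A B assume AB: "A \<in> sets \<Omega>" "B \<in> sets \<Omega>" "A \<inter> B = {}"
    have "\<phi> (chi \<Omega> (A \<union> B)) = \<phi> (chi \<Omega> A) + \<phi> (chi \<Omega> B)"
      by (rule fa_operator_add) (use AB in \<open>simp_all add: chi_meas_hom\<close>, use AB in \<open>auto simp: chi_def indicator_def\<close>)
    then show "Lam \<Omega> \<phi> (A \<union> B) = Lam \<Omega> \<phi> A + Lam \<Omega> \<phi> B"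
      using AB by (simp add: Lam_apply)
  qed
  ultimately show ?thesis by (simp add: fa_prob_measures_def)
qed

text \<open>A simple function is the finite sum of its values times the indicators of its level
  sets. Additivity is applied one value at a time, by induction on a finite set of values.\<close>

lemma fa_simple_integral_Lam:
  assumes f: "f \<in> meas_hom \<Omega> unit_I" and simple: "simple_function \<Omega> f"
  shows "fa_simple_integral \<Omega> (Lam \<Omega> \<phi>) f = \<phi> f"
proof -
  have level [measurable]: "f -` {a} \<inter> space \<Omega> \<in> sets \<Omega>" for a
    using f by measurable
  \<comment> \<open>The partial sum over the values in \<open>B\<close>, written as a truncation of
    \<open>f\<close> so that it visibly stays in the interval.\<close>
  define part where "part B = (\<lambda>\<omega>\<in>space \<Omega>. if f \<omega> \<in> B then f \<omega> else 0)" for B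
  have part_hom: "part B \<in> meas_hom \<Omega> unit_I" if "finite B" for B
    unfolding part_def
  proof (rule meas_hom_unit_restrictI)
    have "B \<in> sets borel" using that by (simp add: finite_imp_closed)
    then show "(\<lambda>\<omega>. if f \<omega> \<in> B then f \<omega> else 0) \<in> borel_measurable \<Omega>"
      using f by measurable
  qed (auto simp: meas_hom_unit_bounds[OF f])
  have "\<phi> (part B) = (\<Sum>a\<in>B. a * \<phi> (chi \<Omega> (f -` {a} \<inter> space \<Omega>)))"
    if "finite B" "B \<subseteq> f ` space \<Omega>" for B
    using that
  proof (induction B)
    case empty
    have empty: "part {} = (\<lambda>\<omega>\<in>space \<Omega>. 0)" by (auto simp: part_def fun_eq_iff)
    show ?case unfolding empty sum.empty by (rule fa_operator_const) simp
  next
    case (insert a B)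
    let ?A = "f -` {a} \<inter> space \<Omega>"
    have a: "a \<in> {0..1}"
      using insert.prems meas_hom_unit_bounds[OF f] by auto
    have chi: "chi \<Omega> ?A \<in> meas_hom \<Omega> unit_I"
      by (rule chi_meas_hom[OF level])
    have "(\<lambda>\<omega>\<in>space \<Omega>. a * chi \<Omega> ?A \<omega>) \<in> meas_hom \<Omega> unit_I"
      using a chi by (intro meas_hom_unit_restrictI)
        (auto intro: mult_le_one borel_measurable_times meas_hom_unit_measurable
              dest: meas_hom_unit_bounds)
    \<comment> \<open>As \<open>a\<close> is not in \<open>B\<close>, the two summands are nonzero
      only on disjoint sets, so they add up to the larger truncation.\<close>
    then have "\<phi> (part (insert a B)) = \<phi> (\<lambda>\<omega>\<in>space \<Omega>. a * chi \<Omega> ?A \<omega>) + \<phi> (part B)"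
      by (rule fa_operator_add)
         (use insert.hyps in \<open>simp_all add: part_hom\<close>,
          use insert.hyps in \<open>auto simp: part_def chi_def indicator_def\<close>)
    with insert show ?case
      by (simp add: fa_operator_scale[OF chi a])
  qed
  from this[of "f ` space \<Omega>"]
  have "\<phi> (part (f ` space \<Omega>)) = fa_simple_integral \<Omega> (Lam \<Omega> \<phi>) f"
    using simple by (simp add: fa_simple_integral_def simple_function_def Lam_apply level)
  moreover have "part (f ` space \<Omega>) = f"
    using meas_hom_extensional[OF f] by (auto simp: part_def fun_eq_iff extensional_def)
  ultimately show ?thesis by simp
qed

text \<open>Monotonicity makes \<open>\<phi> f\<close> an upper bound of the integrals of simple
  minorants. It is the least one because some simple minorants are uniformly close to
  \<open>f\<close>.\<close>

lemma fa_integral_Lam: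
  assumes f: "f \<in> meas_hom \<Omega> unit_I"
  shows "fa_integral \<Omega> (Lam \<Omega> \<phi>) f = \<phi> f"
  unfolding fa_integral_def
proof (rule cSup_eq)
  fix y assume "y \<in> {fa_simple_integral \<Omega> (Lam \<Omega> \<phi>) f' | f'.
     f' \<in> meas_hom \<Omega> unit_I \<and> simple_function \<Omega> f' \<and> (\<forall>\<omega>\<in>space \<Omega>. f' \<omega> \<le> f \<omega>)}"
  then show "y \<le> \<phi> f"
    by (auto simp: fa_simple_integral_Lam intro!: fa_operator_mono f)
next
  fix y assume ub: "\<And>x. x \<in> {fa_simple_integral \<Omega> (Lam \<Omega> \<phi>) f' | f'.
     f' \<in> meas_hom \<Omega> unit_I \<and> simple_function \<Omega> f' \<and> (\<forall>\<omega>\<in>space \<Omega>. f' \<omega> \<le> f \<omega>)} \<Longrightarrow> x \<le> y"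
  have approx: "\<phi> f \<le> y + 1 / real (Suc n)" for n
  proof -
    \<comment> \<open>\<open>Suc n\<close> keeps the denominator nonzero; \<open>of_nat_Suc\<close>
      is removed from the simplifier below so that \<open>?n\<close> stays atomic.\<close>
    let ?n = "real (Suc n)"
    define g where "g = (\<lambda>\<omega>\<in>space \<Omega>. real_of_int \<lfloor>?n * f \<omega>\<rfloor> / ?n)"
    have g_le: "g \<omega> \<le> f \<omega>" and f_le: "f \<omega> - g \<omega> \<le> 1 / ?n" and g_ge: "0 \<le> g \<omega>"
      if "\<omega> \<in> space \<Omega>" for \<omega>
    proof -
      have "real_of_int \<lfloor>?n * f \<omega>\<rfloor> \<le> ?n * f \<omega>" "?n * f \<omega> \<le> real_of_int \<lfloor>?n * f \<omega>\<rfloor> + 1"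
        by linarith+
      moreover have "?n * g \<omega> = real_of_int \<lfloor>?n * f \<omega>\<rfloor>"
        using that by (simp add: g_def del: of_nat_Suc)
      ultimately have "?n * g \<omega> \<le> ?n * f \<omega>" "?n * (f \<omega> - g \<omega>) \<le> 1"
        unfolding right_diff_distrib by linarith+
      then show "g \<omega> \<le> f \<omega>" "f \<omega> - g \<omega> \<le> 1 / ?n"
        by (simp_all add: pos_le_divide_eq mult.commute del: of_nat_Suc)
      show "0 \<le> g \<omega>"
        using that meas_hom_unit_bounds[OF f that] by (simp add: g_def del: of_nat_Suc)
    qed
    have g: "g \<in> meas_hom \<Omega> unit_I"
      unfolding g_def
    proof (rule meas_hom_unit_restrictI)
      show "(\<lambda>\<omega>. real_of_int \<lfloor>?n * f \<omega>\<rfloor> / ?n) \<in> borel_measurable \<Omega>"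
        using f by measurable
      fix \<omega> assume w: "\<omega> \<in> space \<Omega>"
      then have "real_of_int \<lfloor>?n * f \<omega>\<rfloor> / ?n = g \<omega>"
        by (simp add: g_def)
      with g_ge[OF w] g_le[OF w] meas_hom_unit_bounds(2)[OF f w]
      show "0 \<le> real_of_int \<lfloor>?n * f \<omega>\<rfloor> / ?n" "real_of_int \<lfloor>?n * f \<omega>\<rfloor> / ?n \<le> 1"
        by linarith+
    qed
    \<comment> \<open>Rounding down yields only the multiples of \<open>1 / ?n\<close> between 0 and
      1, so \<open>g\<close> has finitely many values and is simple.\<close>
    have "g ` space \<Omega> \<subseteq> (\<lambda>k. real_of_int k / ?n) ` {0..int (Suc n)}"
    proof clarify
      fix \<omega> assume w: "\<omega> \<in> space \<Omega>"
      have "0 \<le> ?n * f \<omega>" "?n * f \<omega> \<le> ?n"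
        using meas_hom_unit_bounds[OF f w] by (simp_all add: mult_left_le del: of_nat_Suc)
      then have "\<lfloor>?n * f \<omega>\<rfloor> \<in> {0..int (Suc n)}"
        unfolding atLeastAtMost_iff zero_le_floor floor_le_iff of_int_of_nat_eq by linarith
      with w show "g \<omega> \<in> (\<lambda>k. real_of_int k / ?n) ` {0..int (Suc n)}"
        by (auto simp: g_def simp del: of_nat_Suc)
    qed
    then have "finite (g ` space \<Omega>)"
      by (rule finite_subset) simp
    then have "simple_function \<Omega> g"
      using meas_hom_unit_measurable[OF g] by (simp add: simple_function_borel_measurable)
    then have "\<phi> g \<le> y"
      using g g_le fa_simple_integral_Lam[OF g] by (intro ub CollectI exI[of _ g]) auto
    moreover note d = fa_operator_diff[OF g f g_le]
    \<comment> \<open>The uniform error is compared with a constant function, which weak averaging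
      evaluates exactly.\<close>
    have "\<phi> (\<lambda>\<omega>\<in>space \<Omega>. f \<omega> - g \<omega>) \<le> \<phi> (\<lambda>\<omega>\<in>space \<Omega>. 1 / ?n)"
      by (rule fa_operator_mono[OF d(1) meas_hom_unit_restrictI]) (use f_le in auto)
    then have "\<phi> (\<lambda>\<omega>\<in>space \<Omega>. f \<omega> - g \<omega>) \<le> 1 / ?n"
      by (simp add: fa_operator_const)
    ultimately show ?thesis using d(2) by linarith
  qed
  show "\<phi> f \<le> y"
  proof (rule field_le_epsilon)
    fix e :: real assume "0 < e"
    then obtain n where "1 / real (Suc n) < e"
      using reals_Archimedean[of e] by (auto simp: inverse_eq_divide)
    with approx[of n] show "\<phi> f \<le> y + e" by linarith
  qed
qed

end

text \<open>Integration against \<open>Lam \<Omega> \<phi>\<close> recovers \<open>\<phi>\<close> on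
  measurable maps; extensionality settles all other arguments.\<close>

lemma Lam_inj_on: "inj_on (Lam \<Omega>) (fa_integration_operators \<Omega>)"
proof (rule inj_onI)
  fix \<phi> \<psi> assume *: "\<phi> \<in> fa_integration_operators \<Omega>" "\<psi> \<in> fa_integration_operators \<Omega>"
    and "Lam \<Omega> \<phi> = Lam \<Omega> \<psi>"
  then have "\<phi> f = \<psi> f" if "f \<in> meas_hom \<Omega> unit_I" for f
    using fa_integral_Lam[OF *(1) that] fa_integral_Lam[OF *(2) that] by simp
  with * show "\<phi> = \<psi>"
    by (intro extensionalityI[of _ "meas_hom \<Omega> unit_I"])
       (auto simp: fa_integration_operators_def PiE_iff)
qed

text \<open>The partial sums of the measures differ from the measure of the union by the value of
  \<open>\<phi>\<close> on the indicator of a remainder. These indicators tend to 0 pointwise, so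
  the continuity condition on \<open>\<phi>\<close> applies.\<close>

lemma Lam_prob_measure:
  assumes \<phi>: "\<phi> \<in> integration_operators \<Omega>"
  shows "Lam \<Omega> \<phi> \<in> prob_measures \<Omega>"
proof -
  have fa: "\<phi> \<in> fa_integration_operators \<Omega>"
    using \<phi> by (simp add: integration_operators_def)
  have "(\<lambda>n. Lam \<Omega> \<phi> (A n)) sums Lam \<Omega> \<phi> (\<Union>n. A n)"
    if A: "range A \<subseteq> sets \<Omega>" and disj: "disjoint_family A" for A :: "nat \<Rightarrow> 'a set"
  proof -
    have U [measurable]: "(\<Union>n. A n) \<in> sets \<Omega>" and An [measurable]: "A n \<in> sets \<Omega>" for n
      using A by auto
    \<comment> \<open>The remainder after the first \<open>n\<close> sets. At \<open>n = 0\<close>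
      it is the whole union, which starts the induction below.\<close>
    define R where "R n = (\<Union>k. A k) - (\<Union>k<n. A k)" for n
    have R [measurable]: "R n \<in> sets \<Omega>" for n
      unfolding R_def by measurable
    have split: "Lam \<Omega> \<phi> (\<Union>n. A n) = (\<Sum>k<n. Lam \<Omega> \<phi> (A k)) + \<phi> (chi \<Omega> (R n))" for n
    proof (induction n)
      case 0
      then show ?case by (simp add: R_def Lam_apply[OF fa])
    next
      case (Suc n)
      have "A n \<inter> A k = {}" if "k < n" for k
        using disj that by (simp add: disjoint_family_on_def)
      then have RR: "R n = A n \<union> R (Suc n)" "A n \<inter> R (Suc n) = {}"
        by (auto simp: R_def lessThan_Suc)
      have "\<phi> (chi \<Omega> (R n)) = \<phi> (chi \<Omega> (A n)) + \<phi> (chi \<Omega> (R (Suc n)))"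
        by (rule fa_operator_add[OF fa])
           (use RR in \<open>simp_all add: chi_meas_hom\<close>, use RR in \<open>auto simp: chi_def indicator_def\<close>)
      with Suc show ?case by (simp add: Lam_apply[OF fa])
    qed
    have "(\<lambda>n. \<phi> (chi \<Omega> (R n))) \<longlonglongrightarrow> 0"
    proof -
      have "(\<lambda>n. chi \<Omega> (R n) \<omega>) \<longlonglongrightarrow> 0" if w: "\<omega> \<in> space \<Omega>" for \<omega>
      proof -
        \<comment> \<open>A point of \<open>A m\<close> is removed from index \<open>Suc m\<close>
          on, and a point outside the union never lies in a remainder.\<close>
        have "\<exists>N. \<forall>n\<ge>N. \<omega> \<notin> R n"
        proof (cases "\<omega> \<in> (\<Union>n. A n)")
          case True
          then obtain m where "\<omega> \<in> A m" by auto
          then show ?thesis by (intro exI[of _ "Suc m"]) (auto simp: R_def)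
        qed (simp add: R_def)
        then have "\<forall>\<^sub>F n in sequentially. chi \<Omega> (R n) \<omega> = 0"
          using w by (simp add: eventually_sequentially chi_def) (metis indicator_simps(2))
        then show ?thesis by (rule tendsto_eventually)
      qed
      with \<phi> show ?thesis
        using chi_meas_hom[OF R] by (simp add: integration_operators_def)
    qed
    then have "(\<lambda>n. Lam \<Omega> \<phi> (\<Union>n. A n) - \<phi> (chi \<Omega> (R n))) \<longlonglongrightarrow> Lam \<Omega> \<phi> (\<Union>n. A n) - 0"
      by (intro tendsto_diff tendsto_const)
    moreover have "Lam \<Omega> \<phi> (\<Union>n. A n) - \<phi> (chi \<Omega> (R n)) = (\<Sum>k<n. Lam \<Omega> \<phi> (A k))" for n
      using split[of n] by simp
    ultimately show ?thesis by (simp add: sums_def)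
  qed
  then show ?thesis
    using Lam_fa_prob_measure[OF fa] by (simp add: prob_measures_def)
qed


section \<open>The monad structure\<close>

text \<open>The flag \<open>c\<close> selects the countably additive functors \<open>T\<close>, \<open>G\<close> over the finitely additive
  \<open>S\<close>, \<open>F\<close>, so that both halves of the theorem are proved at once.\<close>

definition operators :: "bool \<Rightarrow> 'a measure \<Rightarrow> (('a \<Rightarrow> real) \<Rightarrow> real) set" where
  "operators c \<Omega> = (if c then integration_operators \<Omega> else fa_integration_operators \<Omega>)"

definition Iobj :: "bool \<Rightarrow> 'a measure \<Rightarrow> (('a \<Rightarrow> real) \<Rightarrow> real) measure" where
  "Iobj c \<Omega> = eval_space (meas_hom \<Omega> unit_I) (operators c \<Omega>)"

definition Imap :: "bool \<Rightarrow> 'a measure \<Rightarrow> 'b measure \<Rightarrow> ('a \<Rightarrow> 'b) \<Rightarrow>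
    (('a \<Rightarrow> real) \<Rightarrow> real) \<Rightarrow> (('b \<Rightarrow> real) \<Rightarrow> real)" where
  "Imap c \<Omega> \<Omega>' g = (\<lambda>\<phi>\<in>operators c \<Omega>. \<lambda>f\<in>meas_hom \<Omega>' unit_I. \<phi> (compose (space \<Omega>) f g))"

text \<open>There is no flag, since the formula refers to neither functor: the same map serves as
  unit for \<open>S\<close> and for \<open>T\<close>.\<close>

definition Iunit :: "'a measure \<Rightarrow> 'a \<Rightarrow> ('a \<Rightarrow> real) \<Rightarrow> real" where
  "Iunit \<Omega> = (\<lambda>\<omega>\<in>space \<Omega>. \<lambda>f\<in>meas_hom \<Omega> unit_I. f \<omega>)"

definition Imult :: "bool \<Rightarrow> 'a measure \<Rightarrow>
    (((('a \<Rightarrow> real) \<Rightarrow> real) \<Rightarrow> real) \<Rightarrow> real) \<Rightarrow> ('a \<Rightarrow> real) \<Rightarrow> real" where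
  "Imult c \<Omega> = (\<lambda>\<psi>\<in>operators c (Iobj c \<Omega>). \<lambda>f\<in>meas_hom \<Omega> unit_I. \<psi> (ev (Iobj c \<Omega>) f))"

text \<open>A case distinction instead of a flagged \<open>eval_space\<close>, because
  \<open>Gobj\<close> carries the sigma-algebra restricted from \<open>Fobj\<close>.\<close>

definition Pobj :: "bool \<Rightarrow> 'a measure \<Rightarrow> ('a set \<Rightarrow> real) measure" where
  "Pobj c \<Omega> = (if c then Gobj \<Omega> else Fobj \<Omega>)"

definition Pmap :: "bool \<Rightarrow> 'a measure \<Rightarrow> 'b measure \<Rightarrow> ('a \<Rightarrow> 'b) \<Rightarrow> ('a set \<Rightarrow> real) \<Rightarrow> ('b set \<Rightarrow> real)"
  where "Pmap c \<Omega> \<Omega>' g =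
    (\<lambda>\<pi>\<in>space (Pobj c \<Omega>). \<lambda>A\<in>sets \<Omega>'. \<pi> (g -` A \<inter> space \<Omega>))"

definition Pmult :: "bool \<Rightarrow> 'a measure \<Rightarrow> (('a set \<Rightarrow> real) set \<Rightarrow> real) \<Rightarrow> 'a set \<Rightarrow> real" where
  "Pmult c \<Omega> =
    (\<lambda>\<rho>\<in>space (Pobj c (Pobj c \<Omega>)). \<lambda>A\<in>sets \<Omega>. fa_integral (Pobj c \<Omega>) \<rho> (ev (Pobj c \<Omega>) A))"

definition IP :: "bool \<Rightarrow> 'a measure \<Rightarrow> (('a \<Rightarrow> real) \<Rightarrow> real) \<Rightarrow> 'a set \<Rightarrow> real" where
  "IP c \<Omega> = restrict (Lam \<Omega>) (operators c \<Omega>)"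

definition IPIP :: "bool \<Rightarrow> 'a measure \<Rightarrow>
    (((('a \<Rightarrow> real) \<Rightarrow> real) \<Rightarrow> real) \<Rightarrow> real) \<Rightarrow> ('a set \<Rightarrow> real) set \<Rightarrow> real" where
  "IPIP c \<Omega> = compose (operators c (Iobj c \<Omega>))
     (Pmap c (Iobj c \<Omega>) (Pobj c \<Omega>) (IP c \<Omega>)) (IP c (Iobj c \<Omega>))"

lemma space_Iobj [simp]: "space (Iobj c \<Omega>) = operators c \<Omega>"
  by (simp add: Iobj_def)

lemma space_Fobj [simp]: "space (Fobj \<Omega>) = fa_prob_measures \<Omega>"
  by (simp add: Fobj_def)

lemma space_Gobj [simp]: "space (Gobj \<Omega>) = prob_measures \<Omega>"
  by (auto simp: Gobj_def space_restrict_space prob_measures_def)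

text \<open>Equations between whole families of components, so that unfolding rewrites every
  occurrence, including those at iterated objects.\<close>

lemma finitely_additive_instances:
  "Sobj = Iobj False" "Smap = Imap False" "Sunit = Iunit" "Smult = Imult False"
  "Fobj = Pobj False" "Fmap = Pmap False" "Fmult = Pmult False"
  "Lam = IP False" "LamLam = IPIP False"
proof -
  show 1: "Sobj = Iobj False" "Fobj = Pobj False"
    by (simp_all add: fun_eq_iff Sobj_def Iobj_def operators_def Pobj_def)
  show 2: "Smap = Imap False" "Sunit = Iunit" "Smult = Imult False"
    "Fmap = Pmap False" "Fmult = Pmult False"
    by (intro ext, simp add: Smap_def Imap_def Sunit_def Iunit_def Smult_def Imult_def
      Fmap_def Pmap_def Fmult_def Pmult_def 1)+
  show 3: "Lam = IP False"
    by (intro ext) (simp add: IP_def Lam_def 1)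
  show "LamLam = IPIP False"
    by (intro ext) (simp add: IPIP_def LamLam_def 1 2 3)
qed

lemma countably_additive_instances:
  "Tobj = Iobj True" "Tmap = Imap True" "Tunit = Iunit" "Tmult = Imult True"
  "Gobj = Pobj True" "Gmap = Pmap True" "Gunit = Funit" "Gmult = Pmult True"
  "Xi = IP True" "XiXi = IPIP True"
proof -
  show 1: "Tobj = Iobj True" "Gobj = Pobj True"
    by (simp_all add: fun_eq_iff Tobj_def Iobj_def operators_def Pobj_def)
  show 2: "Tmap = Imap True" "Tunit = Iunit" "Tmult = Imult True"
    "Gunit = Funit" "Gmult = Pmult True"
    by (intro ext, simp add: Tmap_def Imap_def Tunit_def Iunit_def Tmult_def Imult_def
      Gunit_def Funit_def Gmult_def Pmult_def 1)+
  \<comment> \<open>Probability measures are finitely additive, so the domain of \<open>Fmap\<close>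
    imposes nothing further on them.\<close>
  show 3: "Gmap = Pmap True"
    by (intro ext)
       (auto simp: Gmap_def Fmap_def Pmap_def Pobj_def prob_measures_def restrict_def)
  show 4: "Xi = IP True"
    by (intro ext) (simp add: IP_def Xi_def 1)
  show "XiXi = IPIP True"
    by (intro ext) (simp add: IPIP_def XiXi_def 1 3 4)
qed

section \<open>Unit, functor and multiplication on operators\<close>

lemma operators_fa: "\<phi> \<in> operators c \<Omega> \<Longrightarrow> \<phi> \<in> fa_integration_operators \<Omega>"
  by (simp add: operators_def integration_operators_def split: if_splits)

lemma operators_extensional: "\<phi> \<in> operators c \<Omega> \<Longrightarrow> \<phi> \<in> extensional (meas_hom \<Omega> unit_I)"
  by (drule operators_fa) (simp add: fa_integration_operators_def PiE_iff)

lemma operators_tendsto: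
  assumes "\<phi> \<in> operators c \<Omega>" c "\<And>n. f n \<in> meas_hom \<Omega> unit_I"
    "\<And>\<omega>. \<omega> \<in> space \<Omega> \<Longrightarrow> (\<lambda>n. f n \<omega>) \<longlonglongrightarrow> 0"
  shows "(\<lambda>n. \<phi> (f n)) \<longlonglongrightarrow> 0"
  using assms by (simp add: operators_def integration_operators_def)

text \<open>Here \<open>L\<close> is \<open>f \<mapsto> f \<circ> g\<close> for the functor and \<open>f \<mapsto> ev\<^sub>f\<close> for the multiplication.\<close>

lemma operators_substI:
  assumes \<psi>: "\<psi> \<in> operators c X"
    and hom: "\<And>f. f \<in> meas_hom \<Omega> unit_I \<Longrightarrow> L f \<in> meas_hom X unit_I"
    and affine: "\<And>f g r. f \<in> meas_hom \<Omega> unit_I \<Longrightarrow> g \<in> meas_hom \<Omega> unit_I \<Longrightarrow> r \<in> {0..1} \<Longrightarrow>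
        L (\<lambda>\<omega>\<in>space \<Omega>. r * f \<omega> + (1 - r) * g \<omega>) = (\<lambda>x\<in>space X. r * L f x + (1 - r) * L g x)"
    and const: "\<And>r. r \<in> {0..1} \<Longrightarrow> L (\<lambda>\<omega>\<in>space \<Omega>. r) = (\<lambda>x\<in>space X. r)"
    and lim: "\<And>f :: nat \<Rightarrow> _. c \<Longrightarrow> (\<And>n. f n \<in> meas_hom \<Omega> unit_I) \<Longrightarrow>
        (\<And>\<omega>. \<omega> \<in> space \<Omega> \<Longrightarrow> (\<lambda>n. f n \<omega>) \<longlonglongrightarrow> 0) \<Longrightarrow>
        (\<And>x. x \<in> space X \<Longrightarrow> (\<lambda>n. L (f n) x) \<longlonglongrightarrow> 0)"
  shows "(\<lambda>f\<in>meas_hom \<Omega> unit_I. \<psi> (L f)) \<in> operators c \<Omega>"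
proof -
  note fa = operators_fa[OF \<psi>]
  have "(\<lambda>f\<in>meas_hom \<Omega> unit_I. \<psi> (L f)) \<in> fa_integration_operators \<Omega>"
    unfolding fa_integration_operators_def
    by (auto simp del: atLeastAtMost_iff
      simp: hom meas_hom_unit_affine meas_hom_unit_const affine const fa_operator_affine[OF fa] fa_operator_const[OF fa])
       (auto simp: fa_operator_bounds[OF fa] hom)
  \<comment> \<open>\<open>lim\<close> carries a null sequence on \<open>\<Omega>\<close> to a null
    sequence on \<open>X\<close>, where the continuity of \<open>\<psi>\<close> takes over.\<close>
  moreover have "(\<lambda>n. \<psi> (L (f n))) \<longlonglongrightarrow> 0"
    if c "\<And>n. f n \<in> meas_hom \<Omega> unit_I" "\<And>\<omega>. \<omega> \<in> space \<Omega> \<Longrightarrow> (\<lambda>n. f n \<omega>) \<longlonglongrightarrow> 0"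
    for f :: "nat \<Rightarrow> _"
    by (rule operators_tendsto[OF \<psi> that(1)]) (use that hom lim in blast)+
  ultimately show ?thesis
    by (auto simp: operators_def integration_operators_def)
qed

text \<open>Affinity and weak averaging hold pointwise at \<open>\<omega>\<close>, and continuity is
  the assumed convergence at that point.\<close>

lemma Iunit_operators:
  assumes "\<omega> \<in> space \<Omega>"
  shows "Iunit \<Omega> \<omega> \<in> operators c \<Omega>"
proof -
  have "(\<lambda>f\<in>meas_hom \<Omega> unit_I. f \<omega>) \<in> fa_integration_operators \<Omega>"
    using assms meas_hom_unit_bounds[OF _ assms]
    by (auto simp: fa_integration_operators_def meas_hom_unit_affine meas_hom_unit_const
      simp del: atLeastAtMost_iff) auto
  then show ?thesis
    using assms by (auto simp: operators_def integration_operators_def Iunit_def)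
qed

lemma Iobj_component: "f \<in> meas_hom \<Omega> unit_I \<Longrightarrow> (\<lambda>\<phi>. \<phi> f) \<in> Iobj c \<Omega> \<rightarrow>\<^sub>M unit_I"
  unfolding Iobj_def
  by (rule measurable_eval_space_component) (auto dest: operators_fa simp: fa_operator_bounds)

text \<open>Applied to the unit, to \<open>Imap\<close> and to \<open>Imult\<close>: following them
  by evaluation at \<open>f\<close> gives \<open>f\<close> itself, evaluation at the composite of
  \<open>f\<close> with \<open>g\<close>, and evaluation at \<open>ev (Iobj c \<Omega>) f\<close>,
  all of them measurable.\<close>

lemma meas_hom_IobjI:
  assumes "h \<in> extensional (space M)" "\<And>x. x \<in> space M \<Longrightarrow> h x \<in> operators c \<Omega>"
    and "\<And>f. f \<in> meas_hom \<Omega> unit_I \<Longrightarrow> (\<lambda>x. h x f) \<in> M \<rightarrow>\<^sub>M unit_I"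
  shows "h \<in> meas_hom M (Iobj c \<Omega>)"
  unfolding meas_hom_def[of M] Iobj_def using assms by (auto intro: measurable_eval_spaceI)

lemma ev_Iobj_meas_hom: "f \<in> meas_hom \<Omega> unit_I \<Longrightarrow> ev (Iobj c \<Omega>) f \<in> meas_hom (Iobj c \<Omega>) unit_I"
  unfolding ev_def by (intro meas_hom_restrictI Iobj_component)

lemma Iunit_meas_hom: "Iunit \<Omega> \<in> meas_hom \<Omega> (Iobj c \<Omega>)"
proof (rule meas_hom_IobjI)
  fix f assume f: "f \<in> meas_hom \<Omega> unit_I"
  have "(\<lambda>\<omega>. Iunit \<Omega> \<omega> f) \<in> \<Omega> \<rightarrow>\<^sub>M unit_I \<longleftrightarrow> f \<in> \<Omega> \<rightarrow>\<^sub>M unit_I"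
    by (rule measurable_cong) (simp add: Iunit_def f)
  with f show "(\<lambda>\<omega>. Iunit \<Omega> \<omega> f) \<in> \<Omega> \<rightarrow>\<^sub>M unit_I"
    by (simp add: meas_hom_def)
qed (simp_all add: Iunit_operators, simp add: Iunit_def)

lemma Imap_operators:
  assumes g: "g \<in> meas_hom \<Omega> \<Omega>'" and \<phi>: "\<phi> \<in> operators c \<Omega>"
  shows "Imap c \<Omega> \<Omega>' g \<phi> \<in> operators c \<Omega>'"
proof -
  have "(\<lambda>f\<in>meas_hom \<Omega>' unit_I. \<phi> (compose (space \<Omega>) f g)) \<in> operators c \<Omega>'"
    by (rule operators_substI[OF \<phi>])
       (use meas_hom_space[OF g] in \<open>auto simp: compose_def fun_eq_iff
        intro!: meas_hom_compose[OF g, unfolded compose_def]\<close>)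
  with \<phi> show ?thesis by (simp add: Imap_def)
qed

lemma Imap_meas_hom:
  assumes g: "g \<in> meas_hom \<Omega> \<Omega>'"
  shows "Imap c \<Omega> \<Omega>' g \<in> meas_hom (Iobj c \<Omega>) (Iobj c \<Omega>')"
proof (rule meas_hom_IobjI)
  fix f assume f: "f \<in> meas_hom \<Omega>' unit_I"
  have "(\<lambda>\<phi>. Imap c \<Omega> \<Omega>' g \<phi> f) \<in> Iobj c \<Omega> \<rightarrow>\<^sub>M unit_I \<longleftrightarrow>
      (\<lambda>\<phi>. \<phi> (compose (space \<Omega>) f g)) \<in> Iobj c \<Omega> \<rightarrow>\<^sub>M unit_I"
    by (rule measurable_cong) (simp add: Imap_def f)
  then show "(\<lambda>\<phi>. Imap c \<Omega> \<Omega>' g \<phi> f) \<in> Iobj c \<Omega> \<rightarrow>\<^sub>M unit_I"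
    using Iobj_component[OF meas_hom_compose[OF g f]] by simp
qed (simp_all add: Imap_operators g, simp add: Imap_def)

text \<open>Continuity enters twice: that of each \<open>\<phi>\<close> makes the evaluations at a
  null sequence tend to 0 pointwise, and that of \<open>\<psi>\<close> then gives the limit of the
  values.\<close>

lemma Imult_operators:
  assumes \<psi>: "\<psi> \<in> operators c (Iobj c \<Omega>)"
  shows "Imult c \<Omega> \<psi> \<in> operators c \<Omega>"
proof -
  have "(\<lambda>f\<in>meas_hom \<Omega> unit_I. \<psi> (ev (Iobj c \<Omega>) f)) \<in> operators c \<Omega>"
  proof (rule operators_substI[OF \<psi>])
    fix f :: "nat \<Rightarrow> 'a \<Rightarrow> real" and \<phi>
    assume "c" "\<And>n. f n \<in> meas_hom \<Omega> unit_I"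
      "\<And>\<omega>. \<omega> \<in> space \<Omega> \<Longrightarrow> (\<lambda>n. f n \<omega>) \<longlonglongrightarrow> 0" "\<phi> \<in> space (Iobj c \<Omega>)"
    then show "(\<lambda>n. ev (Iobj c \<Omega>) (f n) \<phi>) \<longlonglongrightarrow> 0"
      by (simp add: ev_def operators_tendsto[where f = f])
  qed (simp_all add: ev_Iobj_meas_hom,
       auto simp: ev_def fun_eq_iff meas_hom_unit_affine meas_hom_unit_const
         fa_operator_affine[OF operators_fa] fa_operator_const[OF operators_fa])
  with \<psi> show ?thesis by (simp add: Imult_def)
qed

lemma Imult_meas_hom: "Imult c \<Omega> \<in> meas_hom (Iobj c (Iobj c \<Omega>)) (Iobj c \<Omega>)"
proof (rule meas_hom_IobjI)
  fix f assume f: "f \<in> meas_hom \<Omega> unit_I"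
  have "(\<lambda>\<psi>. Imult c \<Omega> \<psi> f) \<in> Iobj c (Iobj c \<Omega>) \<rightarrow>\<^sub>M unit_I \<longleftrightarrow>
      (\<lambda>\<psi>. \<psi> (ev (Iobj c \<Omega>) f)) \<in> Iobj c (Iobj c \<Omega>) \<rightarrow>\<^sub>M unit_I"
    by (rule measurable_cong) (simp add: Imult_def f)
  then show "(\<lambda>\<psi>. Imult c \<Omega> \<psi> f) \<in> Iobj c (Iobj c \<Omega>) \<rightarrow>\<^sub>M unit_I"
    using Iobj_component[OF ev_Iobj_meas_hom[OF f]] by simp
qed (simp_all add: Imult_operators, simp add: Imult_def)

section \<open>Monad laws and naturality\<close>

lemma monad_at_I:
  "monad_at \<Omega> (Iobj c \<Omega>) (Iobj c (Iobj c \<Omega>)) (Iobj c (Iobj c (Iobj c \<Omega>)))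
     (Iunit \<Omega>) (Imult c \<Omega>) (Iunit (Iobj c \<Omega>)) (Imult c (Iobj c \<Omega>))
     (Imap c \<Omega> (Iobj c \<Omega>) (Iunit \<Omega>)) (Imap c (Iobj c (Iobj c \<Omega>)) (Iobj c \<Omega>) (Imult c \<Omega>))"
  unfolding monad_at_def
proof (intro conjI Iunit_meas_hom Imult_meas_hom)
  \<comment> \<open>Multiplication replaces the test function \<open>f\<close> by its evaluation,
    and the unit at \<open>\<phi>\<close> evaluates that at \<open>\<phi>\<close>.\<close>
  have "Imult c \<Omega> (Iunit (Iobj c \<Omega>) \<phi>) = \<phi>" if \<phi>: "\<phi> \<in> operators c \<Omega>" for \<phi>
  proof (rule extensionalityI)
    fix f assume f: "f \<in> meas_hom \<Omega> unit_I"
    then show "Imult c \<Omega> (Iunit (Iobj c \<Omega>) \<phi>) f = \<phi> f"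
      using \<phi> Iunit_operators[of \<phi> "Iobj c \<Omega>" c] ev_Iobj_meas_hom[OF f]
      by (simp add: Imult_def Iunit_def ev_def)
  qed (use \<phi> in \<open>auto intro!: operators_extensional Imult_operators Iunit_operators\<close>)
  then show "compose (space (Iobj c \<Omega>)) (Imult c \<Omega>) (Iunit (Iobj c \<Omega>)) = id_map (Iobj c \<Omega>)"
    by (auto simp: compose_def id_map_def fun_eq_iff)
next
  have "Imult c \<Omega> (Imap c \<Omega> (Iobj c \<Omega>) (Iunit \<Omega>) \<phi>) = \<phi>" if \<phi>: "\<phi> \<in> operators c \<Omega>" for \<phi>
  proof (rule extensionalityI)
    fix f assume f: "f \<in> meas_hom \<Omega> unit_I"
    \<comment> \<open>Once both outer maps are unfolded, the second unit law is this identity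
      between the arguments of \<open>\<phi>\<close>.\<close>
    have "compose (space \<Omega>) (ev (Iobj c \<Omega>) f) (Iunit \<Omega>) = f"
      using f meas_hom_extensional[OF f]
      by (auto simp: compose_def ev_def Iunit_operators fun_eq_iff extensional_def)
         (simp add: Iunit_def)
    \<comment> \<open>Simplification runs in two stages, here and in similar places: the membership
      facts match the inner term only while it is folded, so the outer map is unfolded
      first.\<close>
    then show "Imult c \<Omega> (Imap c \<Omega> (Iobj c \<Omega>) (Iunit \<Omega>) \<phi>) f = \<phi> f"
      using \<phi> f Imap_operators[OF Iunit_meas_hom \<phi>] ev_Iobj_meas_hom[OF f, of c]
      by (simp add: Imult_def) (simp add: Imap_def)
  qed (use \<phi> in \<open>auto intro!: operators_extensional Imult_operators Imap_operators Iunit_meas_hom\<close>)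
  then show "compose (space (Iobj c \<Omega>)) (Imult c \<Omega>) (Imap c \<Omega> (Iobj c \<Omega>) (Iunit \<Omega>)) = id_map (Iobj c \<Omega>)"
    by (auto simp: compose_def id_map_def fun_eq_iff)
next
  let ?\<mu> = "Imult c \<Omega>" and ?\<mu>1 = "Imult c (Iobj c \<Omega>)"
    and ?H\<mu> = "Imap c (Iobj c (Iobj c \<Omega>)) (Iobj c \<Omega>) (Imult c \<Omega>)"
  have "?\<mu> (?\<mu>1 \<Psi>) = ?\<mu> (?H\<mu> \<Psi>)" if \<Psi>: "\<Psi> \<in> operators c (Iobj c (Iobj c \<Omega>))" for \<Psi>
  proof (rule extensionalityI)
    fix f assume f: "f \<in> meas_hom \<Omega> unit_I"
    note e = ev_Iobj_meas_hom[OF f, of c]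
    \<comment> \<open>Both sides of associativity apply \<open>\<Psi>\<close> to a function; this
      identity says that the two functions agree.\<close>
    have "compose (space (Iobj c (Iobj c \<Omega>))) (ev (Iobj c \<Omega>) f) ?\<mu> =
        ev (Iobj c (Iobj c \<Omega>)) (ev (Iobj c \<Omega>) f)"
      by (auto simp: compose_def ev_def Imult_operators fun_eq_iff)
         (simp add: Imult_def f ev_def)
    then show "?\<mu> (?\<mu>1 \<Psi>) f = ?\<mu> (?H\<mu> \<Psi>) f"
      using \<Psi> f e Imult_operators[OF \<Psi>] Imap_operators[OF Imult_meas_hom \<Psi>]
      by (simp add: Imult_def[of c \<Omega>]) (simp add: Imap_def Imult_def)
  qed (use \<Psi> in \<open>auto intro!: operators_extensional Imult_operators Imap_operators Imult_meas_hom\<close>)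
  then show "compose (space (Iobj c (Iobj c (Iobj c \<Omega>)))) ?\<mu> ?\<mu>1 =
      compose (space (Iobj c (Iobj c (Iobj c \<Omega>)))) ?\<mu> ?H\<mu>"
    by (auto simp: compose_def fun_eq_iff)
qed

lemma natural_at_Iunit: "natural_at \<Omega> \<Omega>' \<Omega> (\<lambda>g. g) (Imap c \<Omega> \<Omega>') (Iunit \<Omega>) (Iunit \<Omega>')"
  unfolding natural_at_def
proof
  fix g assume g: "g \<in> meas_hom \<Omega> \<Omega>'"
  have "Iunit \<Omega>' (g \<omega>) = Imap c \<Omega> \<Omega>' g (Iunit \<Omega> \<omega>)" if w: "\<omega> \<in> space \<Omega>" for \<omega>
    using w g meas_hom_space[OF g w] Iunit_operators[OF w, of c] meas_hom_compose[OF g]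
    by (auto simp: Imap_def fun_eq_iff) (auto simp: Iunit_def compose_def restrict_def)
  then show "compose (space \<Omega>) (Iunit \<Omega>') g = compose (space \<Omega>) (Imap c \<Omega> \<Omega>' g) (Iunit \<Omega>)"
    by (auto simp: compose_def fun_eq_iff)
qed

text \<open>Tested on \<open>f\<close>, both sides apply \<open>\<psi>\<close>: one to the
  evaluation at \<open>f\<close> after \<open>Imap c \<Omega> \<Omega>' g\<close>, the other to the
  evaluation at the composite of \<open>f\<close> with \<open>g\<close>. These two functions
  coincide.\<close>

lemma natural_at_Imult:
  "natural_at \<Omega> \<Omega>' (Iobj c (Iobj c \<Omega>)) (\<lambda>g. Imap c (Iobj c \<Omega>) (Iobj c \<Omega>') (Imap c \<Omega> \<Omega>' g))
     (Imap c \<Omega> \<Omega>') (Imult c \<Omega>) (Imult c \<Omega>')"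
  unfolding natural_at_def
proof
  fix g assume g: "g \<in> meas_hom \<Omega> \<Omega>'"
  let ?Ig = "Imap c \<Omega> \<Omega>' g"
  have "Imult c \<Omega>' (Imap c (Iobj c \<Omega>) (Iobj c \<Omega>') ?Ig \<psi>) = ?Ig (Imult c \<Omega> \<psi>)"
    if \<psi>: "\<psi> \<in> operators c (Iobj c \<Omega>)" for \<psi>
  proof (rule extensionalityI)
    fix f assume f: "f \<in> meas_hom \<Omega>' unit_I"
    note gf = meas_hom_compose[OF g f]
    have "compose (operators c \<Omega>) (ev (Iobj c \<Omega>') f) ?Ig =
        ev (Iobj c \<Omega>) (compose (space \<Omega>) f g)"
      by (auto simp: compose_def ev_def Imap_operators[OF g] fun_eq_iff)
         (simp add: Imap_def f compose_def)
    then show "Imult c \<Omega>' (Imap c (Iobj c \<Omega>) (Iobj c \<Omega>') ?Ig \<psi>) f = ?Ig (Imult c \<Omega> \<psi>) f"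
      using \<psi> f gf ev_Iobj_meas_hom[OF f, of c] Imult_operators[OF \<psi>]
        Imap_operators[OF Imap_meas_hom[OF g] \<psi>]
      by (simp add: Imult_def[of c \<Omega>'] Imap_def[of c \<Omega>])
         (simp add: Imult_def Imap_def)
  qed (use \<psi> in \<open>auto intro!: operators_extensional Imult_operators Imap_operators Imap_meas_hom g\<close>)
  then show "compose (space (Iobj c (Iobj c \<Omega>))) (Imult c \<Omega>')
      (Imap c (Iobj c \<Omega>) (Iobj c \<Omega>') ?Ig) =
    compose (space (Iobj c (Iobj c \<Omega>))) ?Ig (Imult c \<Omega>)"
    by (auto simp: compose_def fun_eq_iff)
qed


section \<open>Comparison with the Giry monads\<close>

lemma IP_apply: "\<phi> \<in> operators c \<Omega> \<Longrightarrow> A \<in> sets \<Omega> \<Longrightarrow> IP c \<Omega> \<phi> A = \<phi> (chi \<Omega> A)"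
  by (simp add: IP_def Lam_apply[OF operators_fa])

lemma Pobj_fa: "\<pi> \<in> space (Pobj c \<Omega>) \<Longrightarrow> \<pi> \<in> fa_prob_measures \<Omega>"
  by (auto simp: Pobj_def prob_measures_def split: if_splits)

lemma Pobj_extensional: "\<pi> \<in> space (Pobj c \<Omega>) \<Longrightarrow> \<pi> \<in> extensional (sets \<Omega>)"
  by (drule Pobj_fa) (simp add: fa_prob_measures_def PiE_iff)

lemma IP_space: "\<phi> \<in> operators c \<Omega> \<Longrightarrow> IP c \<Omega> \<phi> \<in> space (Pobj c \<Omega>)"
  by (auto simp: IP_def Pobj_def operators_def Lam_prob_measure Lam_fa_prob_measure)

lemma Pobj_component:
  assumes "A \<in> sets \<Omega>"
  shows "(\<lambda>\<pi>. \<pi> A) \<in> Pobj c \<Omega> \<rightarrow>\<^sub>M unit_I"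
proof -
  have "(\<lambda>\<pi>. \<pi> A) \<in> Fobj \<Omega> \<rightarrow>\<^sub>M unit_I"
    unfolding Fobj_def using assms
    by (intro measurable_eval_space_component) (auto simp: fa_prob_measures_def simp del: atLeastAtMost_iff)
  then show ?thesis
    by (simp add: Pobj_def Gobj_def measurable_restrict_space1)
qed

lemma ev_Pobj_meas_hom: "A \<in> sets \<Omega> \<Longrightarrow> ev (Pobj c \<Omega>) A \<in> meas_hom (Pobj c \<Omega>) unit_I"
  unfolding ev_def by (intro meas_hom_restrictI Pobj_component)

text \<open>Evaluating at \<open>A\<close> after the comparison is evaluating at
  \<open>chi \<Omega> A\<close>, which gives measurability into \<open>Fobj\<close>. For
  \<open>c\<close> true the values are probability measures, so the map corestricts to the
  subspace.\<close>

lemma IP_meas_hom: "IP c \<Omega> \<in> meas_hom (Iobj c \<Omega>) (Pobj c \<Omega>)"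
proof -
  have "IP c \<Omega> \<in> Iobj c \<Omega> \<rightarrow>\<^sub>M Fobj \<Omega>"
    unfolding Fobj_def
  proof (rule measurable_eval_spaceI)
    fix A assume A: "A \<in> sets \<Omega>"
    have "(\<lambda>\<phi>. IP c \<Omega> \<phi> A) \<in> Iobj c \<Omega> \<rightarrow>\<^sub>M unit_I \<longleftrightarrow>
        (\<lambda>\<phi>. \<phi> (chi \<Omega> A)) \<in> Iobj c \<Omega> \<rightarrow>\<^sub>M unit_I"
      by (rule measurable_cong) (simp add: IP_apply A)
    then show "(\<lambda>\<phi>. IP c \<Omega> \<phi> A) \<in> Iobj c \<Omega> \<rightarrow>\<^sub>M unit_I"
      using Iobj_component[OF chi_meas_hom[OF A]] by simp
  qed (auto dest: IP_space Pobj_fa)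
  then have "IP c \<Omega> \<in> Iobj c \<Omega> \<rightarrow>\<^sub>M Pobj c \<Omega>"
    using IP_space[of _ c \<Omega>] by (cases c) (auto simp: Pobj_def Gobj_def measurable_restrict_space2_iff space_restrict_space)
  then show ?thesis by (simp add: meas_hom_def IP_def)
qed

lemma natural_at_IP:
  "natural_at \<Omega> \<Omega>' (Iobj c \<Omega>) (Imap c \<Omega> \<Omega>') (Pmap c \<Omega> \<Omega>') (IP c \<Omega>) (IP c \<Omega>')"
  unfolding natural_at_def
proof
  fix g assume g: "g \<in> meas_hom \<Omega> \<Omega>'"
  have "IP c \<Omega>' (Imap c \<Omega> \<Omega>' g \<phi>) = Pmap c \<Omega> \<Omega>' g (IP c \<Omega> \<phi>)"
    if \<phi>: "\<phi> \<in> operators c \<Omega>" for \<phi>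
  proof (rule extensionalityI)
    fix A assume A: "A \<in> sets \<Omega>'"
    then have "g -` A \<inter> space \<Omega> \<in> sets \<Omega>"
      using g by (auto simp: meas_hom_def intro: measurable_sets)
    then show "IP c \<Omega>' (Imap c \<Omega> \<Omega>' g \<phi>) A = Pmap c \<Omega> \<Omega>' g (IP c \<Omega> \<phi>) A"
      using A \<phi> IP_space[OF \<phi>] chi_meas_hom[OF A] chi_compose[OF g]
      by (simp add: IP_apply Imap_operators g Pmap_def) (simp add: Imap_def)
  next
    show "IP c \<Omega>' (Imap c \<Omega> \<Omega>' g \<phi>) \<in> extensional (sets \<Omega>')"
      by (intro Pobj_extensional[of _ c] IP_space Imap_operators g \<phi>)
  qed (use IP_space[OF \<phi>] in \<open>simp add: Pmap_def\<close>)
  then show "compose (space (Iobj c \<Omega>)) (IP c \<Omega>') (Imap c \<Omega> \<Omega>' g) =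
      compose (space (Iobj c \<Omega>)) (Pmap c \<Omega> \<Omega>' g) (IP c \<Omega>)"
    by (auto simp: compose_def fun_eq_iff)
qed

lemma monad_morphism_at_IP:
  "monad_morphism_at \<Omega> (Iobj c (Iobj c \<Omega>)) (IP c \<Omega>) (IPIP c \<Omega>)
     (Iunit \<Omega>) (Imult c \<Omega>) (Funit \<Omega>) (Pmult c \<Omega>)"
  unfolding monad_morphism_at_def
proof
  have "IP c \<Omega> (Iunit \<Omega> \<omega>) = Funit \<Omega> \<omega>" if w: "\<omega> \<in> space \<Omega>" for \<omega>
  proof (rule extensionalityI)
    fix A assume A: "A \<in> sets \<Omega>"
    then show "IP c \<Omega> (Iunit \<Omega> \<omega>) A = Funit \<Omega> \<omega> A"
      using w chi_meas_hom[OF A] by (simp add: IP_apply Iunit_operators) (simp add: Iunit_def Funit_def)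
  next
    show "IP c \<Omega> (Iunit \<Omega> \<omega>) \<in> extensional (sets \<Omega>)"
      by (intro Pobj_extensional[of _ c] IP_space Iunit_operators w)
  qed (use w in \<open>simp add: Funit_def\<close>)
  then show "compose (space \<Omega>) (IP c \<Omega>) (Iunit \<Omega>) = Funit \<Omega>"
    by (auto simp: compose_def fun_eq_iff Funit_def)
next
  have "IP c \<Omega> (Imult c \<Omega> \<psi>) = Pmult c \<Omega> (IPIP c \<Omega> \<psi>)"
    if \<psi>: "\<psi> \<in> operators c (Iobj c \<Omega>)" for \<psi>
  proof -
    define \<psi>' where "\<psi>' = Imap c (Iobj c \<Omega>) (Pobj c \<Omega>) (IP c \<Omega>) \<psi>"
    have \<psi>': "\<psi>' \<in> operators c (Pobj c \<Omega>)"
      unfolding \<psi>'_def by (rule Imap_operators[OF IP_meas_hom \<psi>])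
    \<comment> \<open>Naturality of the comparison at the morphism \<open>IP c \<Omega>\<close>
      exchanges the two factors of the horizontal composite. The measure to integrate against is
      thereby induced by an operator, as \<open>fa_integral_Lam\<close> requires.\<close>
    have IPIP: "IPIP c \<Omega> \<psi> = IP c (Pobj c \<Omega>) \<psi>'"
      using fun_cong[OF bspec[OF natural_at_IP[of "Iobj c \<Omega>" "Pobj c \<Omega>" c,
            unfolded natural_at_def] IP_meas_hom], where x = \<psi>] \<psi>
      by (simp add: IPIP_def \<psi>'_def compose_def)
    show ?thesis
    proof (rule extensionalityI)
      fix A assume A: "A \<in> sets \<Omega>"
      note chi = chi_meas_hom[OF A] and e = ev_Pobj_meas_hom[OF A, of c]
      have "Pmult c \<Omega> (IPIP c \<Omega> \<psi>) A = fa_integral (Pobj c \<Omega>) (Lam (Pobj c \<Omega>) \<psi>') (ev (Pobj c \<Omega>) A)"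
        using A \<psi>' IP_space[OF \<psi>'] by (simp add: Pmult_def IPIP) (simp add: IP_def)
      also have "\<dots> = \<psi>' (ev (Pobj c \<Omega>) A)"
        by (rule fa_integral_Lam[OF operators_fa[OF \<psi>'] e])
      also have "\<dots> = \<psi> (compose (operators c \<Omega>) (ev (Pobj c \<Omega>) A) (IP c \<Omega>))"
        using \<psi> e by (simp add: \<psi>'_def Imap_def)
      also have "compose (operators c \<Omega>) (ev (Pobj c \<Omega>) A) (IP c \<Omega>) = ev (Iobj c \<Omega>) (chi \<Omega> A)"
        using A by (auto simp: compose_def ev_def fun_eq_iff IP_space IP_apply)
      also have "\<psi> (ev (Iobj c \<Omega>) (chi \<Omega> A)) = IP c \<Omega> (Imult c \<Omega> \<psi>) A"
        using \<psi> A chi by (simp add: IP_apply Imult_operators) (simp add: Imult_def)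
      finally show "IP c \<Omega> (Imult c \<Omega> \<psi>) A = Pmult c \<Omega> (IPIP c \<Omega> \<psi>) A" ..
    next
      show "IP c \<Omega> (Imult c \<Omega> \<psi>) \<in> extensional (sets \<Omega>)"
        by (intro Pobj_extensional[of _ c] IP_space Imult_operators \<psi>)
    qed (use IP_space[OF \<psi>'] in \<open>simp add: Pmult_def IPIP\<close>)
  qed
  then show "compose (space (Iobj c (Iobj c \<Omega>))) (IP c \<Omega>) (Imult c \<Omega>) =
      compose (space (Iobj c (Iobj c \<Omega>))) (Pmult c \<Omega>) (IPIP c \<Omega>)"
    by (auto simp: compose_def fun_eq_iff)
qed

section \<open>Uniqueness of the induced structure\<close>

lemma IP_cancel:
  assumes "compose (space X) (IP c \<Omega>) h = compose (space X) (IP c \<Omega>) k"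
    and h: "h \<in> meas_hom X (Iobj c \<Omega>)" and k: "k \<in> meas_hom X (Iobj c \<Omega>)"
  shows "h = k"
proof (rule extensionalityI)
  show "h \<in> extensional (space X)" "k \<in> extensional (space X)"
    using h k by (auto dest: meas_hom_extensional)
  fix x assume x: "x \<in> space X"
  have hk: "h x \<in> operators c \<Omega>" "k x \<in> operators c \<Omega>"
    using meas_hom_space[OF h x] meas_hom_space[OF k x] by simp_all
  have "IP c \<Omega> (h x) = IP c \<Omega> (k x)"
    using fun_cong[OF assms(1), of x] x by (simp add: compose_def)
  then show "h x = k x"
    using hk operators_fa by (auto simp: IP_def dest: inj_onD[OF Lam_inj_on])
qed

text \<open>The right-hand sides of the two compatibility equations mention neither
  \<open>\<eta>\<close> nor \<open>\<mu>\<close>. So both agree with the explicit maps after the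
  comparison, which is injective and can be cancelled.\<close>

lemma monad_morphism_at_IP_unique:
  assumes "\<eta> \<in> meas_hom \<Omega> (Iobj c \<Omega>)" "\<mu> \<in> meas_hom (Iobj c (Iobj c \<Omega>)) (Iobj c \<Omega>)"
    and "monad_morphism_at \<Omega> (Iobj c (Iobj c \<Omega>)) (IP c \<Omega>) (IPIP c \<Omega>) \<eta> \<mu> (Funit \<Omega>) (Pmult c \<Omega>)"
  shows "\<eta> = Iunit \<Omega> \<and> \<mu> = Imult c \<Omega>"
proof
  show "\<eta> = Iunit \<Omega>"
    using assms monad_morphism_at_IP[of \<Omega> c] unfolding monad_morphism_at_def
    by (intro IP_cancel[of \<Omega> c \<Omega>] Iunit_meas_hom) auto
  show "\<mu> = Imult c \<Omega>"
    using assms monad_morphism_at_IP[of \<Omega> c] unfolding monad_morphism_at_def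
    by (intro IP_cancel[of "Iobj c (Iobj c \<Omega>)" c \<Omega>] Imult_meas_hom) auto
qed

text \<open>Competitors in the uniqueness clauses are arbitrary measurable components compatible
  with the comparison, a class that contains those of every monad structure in question. After
  unfolding, the halves are the instances of the flagged lemmas at \<open>False\<close> and
  \<open>True\<close>.\<close>

theorem proposition3p9:
  fixes \<Omega> :: "'a measure" and \<Omega>' :: "'b measure"
  shows
   "(monad_at \<Omega> (Sobj \<Omega>) (Sobj (Sobj \<Omega>)) (Sobj (Sobj (Sobj \<Omega>)))
       (Sunit \<Omega>) (Smult \<Omega>) (Sunit (Sobj \<Omega>)) (Smult (Sobj \<Omega>))
       (Smap \<Omega> (Sobj \<Omega>) (Sunit \<Omega>)) (Smap (Sobj (Sobj \<Omega>)) (Sobj \<Omega>) (Smult \<Omega>)) \<and>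
     natural_at \<Omega> \<Omega>' \<Omega> (\<lambda>g. g) (Smap \<Omega> \<Omega>') (Sunit \<Omega>) (Sunit \<Omega>') \<and>
     natural_at \<Omega> \<Omega>' (Sobj (Sobj \<Omega>)) (\<lambda>g. Smap (Sobj \<Omega>) (Sobj \<Omega>') (Smap \<Omega> \<Omega>' g)) (Smap \<Omega> \<Omega>')
       (Smult \<Omega>) (Smult \<Omega>') \<and>
     Lam \<Omega> \<in> meas_hom (Sobj \<Omega>) (Fobj \<Omega>) \<and>
     natural_at \<Omega> \<Omega>' (Sobj \<Omega>) (Smap \<Omega> \<Omega>') (Fmap \<Omega> \<Omega>') (Lam \<Omega>) (Lam \<Omega>') \<and>
     monad_morphism_at \<Omega> (Sobj (Sobj \<Omega>)) (Lam \<Omega>) (LamLam \<Omega>)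
       (Sunit \<Omega>) (Smult \<Omega>) (Funit \<Omega>) (Fmult \<Omega>) \<and>
     (\<forall>\<eta>\<in>meas_hom \<Omega> (Sobj \<Omega>). \<forall>\<mu>\<in>meas_hom (Sobj (Sobj \<Omega>)) (Sobj \<Omega>).
        monad_morphism_at \<Omega> (Sobj (Sobj \<Omega>)) (Lam \<Omega>) (LamLam \<Omega>) \<eta> \<mu> (Funit \<Omega>) (Fmult \<Omega>) \<longrightarrow>
        \<eta> = Sunit \<Omega> \<and> \<mu> = Smult \<Omega>))
    \<and>
    (monad_at \<Omega> (Tobj \<Omega>) (Tobj (Tobj \<Omega>)) (Tobj (Tobj (Tobj \<Omega>)))
       (Tunit \<Omega>) (Tmult \<Omega>) (Tunit (Tobj \<Omega>)) (Tmult (Tobj \<Omega>))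
       (Tmap \<Omega> (Tobj \<Omega>) (Tunit \<Omega>)) (Tmap (Tobj (Tobj \<Omega>)) (Tobj \<Omega>) (Tmult \<Omega>)) \<and>
     natural_at \<Omega> \<Omega>' \<Omega> (\<lambda>g. g) (Tmap \<Omega> \<Omega>') (Tunit \<Omega>) (Tunit \<Omega>') \<and>
     natural_at \<Omega> \<Omega>' (Tobj (Tobj \<Omega>)) (\<lambda>g. Tmap (Tobj \<Omega>) (Tobj \<Omega>') (Tmap \<Omega> \<Omega>' g)) (Tmap \<Omega> \<Omega>')
       (Tmult \<Omega>) (Tmult \<Omega>') \<and>
     Xi \<Omega> \<in> meas_hom (Tobj \<Omega>) (Gobj \<Omega>) \<and>
     natural_at \<Omega> \<Omega>' (Tobj \<Omega>) (Tmap \<Omega> \<Omega>') (Gmap \<Omega> \<Omega>') (Xi \<Omega>) (Xi \<Omega>') \<and>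
     monad_morphism_at \<Omega> (Tobj (Tobj \<Omega>)) (Xi \<Omega>) (XiXi \<Omega>)
       (Tunit \<Omega>) (Tmult \<Omega>) (Gunit \<Omega>) (Gmult \<Omega>) \<and>
     (\<forall>\<eta>\<in>meas_hom \<Omega> (Tobj \<Omega>). \<forall>\<mu>\<in>meas_hom (Tobj (Tobj \<Omega>)) (Tobj \<Omega>).
        monad_morphism_at \<Omega> (Tobj (Tobj \<Omega>)) (Xi \<Omega>) (XiXi \<Omega>) \<eta> \<mu> (Gunit \<Omega>) (Gmult \<Omega>) \<longrightarrow>
        \<eta> = Tunit \<Omega> \<and> \<mu> = Tmult \<Omega>))"
  unfolding finitely_additive_instances countably_additive_instances
  by (intro conjI ballI impI monad_at_I natural_at_Iunit natural_at_Imult IP_meas_hom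
      natural_at_IP monad_morphism_at_IP)
     (use monad_morphism_at_IP_unique in blast)+

end
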